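(* Let $d$ be a positive integer and $0\le\beta<\alpha<1$. Among all distributions $\mathcal{H}$ over Boolean functions $h\colon\{-1,1\}^d\to\{-1,1\}$, any distribution minimizing $$\rho_{\alpha,\beta}=\frac{\log\big(1/\Pr_{h\sim\mathcal{H},(x,y)\ \alpha\text{-corr.}}[h(x)=h(y)]\big)}{\log\big(1/\Pr_{h\sim\mathcal{H},(x,y)\ \beta\text{-corr.}}[h(x)=h(y)]\big)}$$ assigns nonzero probability only to dictator functions, i.e. functions of the form $h(x)=x_i$ or $h(x)=-x_i$ for some $i\in\{1,\dots,d\}$.
   Context: For $-1\le\alpha\le1$, a pair $(x,y)$ is randomly $\alpha$-correlated if $x$ is uniform in $\{-1,1\}^d$ and, independently for each coordinate, $y_i=x_i$ with probability $(1+\alpha)/2$ and $y_i=-x_i$ with probability $(1-\alpha)/2$; in the probabilities above $h\sim\mathcal{H}$ is independent of $(x,y)$. *)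

theory Defs
  imports "HOL-Probability.Probability"
begin

definition cube :: "nat \<Rightarrow> (nat \<Rightarrow> int) set" where
  "cube d = {1..d} \<rightarrow>\<^sub>E {-1, 1}"

definition boolean_functions :: "nat \<Rightarrow> ((nat \<Rightarrow> int) \<Rightarrow> int) set" where
  "boolean_functions d = cube d \<rightarrow>\<^sub>E {-1, 1}"

definition correlated_pair :: "nat \<Rightarrow> real \<Rightarrow> ((nat \<Rightarrow> int) \<times> (nat \<Rightarrow> int)) pmf" where
  "correlated_pair d \<alpha> =
     do {
       x \<leftarrow> pmf_of_set (cube d);
       y \<leftarrow> Pi_pmf {1..d} undefined
              (\<lambda>i. map_pmf (\<lambda>b. if b then x i else - x i) (bernoulli_pmf ((1 + \<alpha>) / 2)));
       return_pmf (x, y)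
     }"

definition collision_prob :: "nat \<Rightarrow> real \<Rightarrow> ((nat \<Rightarrow> int) \<Rightarrow> int) pmf \<Rightarrow> real" where
  "collision_prob d \<alpha> H =
     measure_pmf.prob (pair_pmf H (correlated_pair d \<alpha>)) {(h, (x, y)). h x = h y}"

definition rho :: "nat \<Rightarrow> real \<Rightarrow> real \<Rightarrow> ((nat \<Rightarrow> int) \<Rightarrow> int) pmf \<Rightarrow> real" where
  "rho d \<alpha> \<beta> H = ln (1 / collision_prob d \<alpha> H) / ln (1 / collision_prob d \<beta> H)"

text \<open>
  The second conjunct says that the quotient defining \<open>rho\<close> is meaningful. It excludes only the
  distributions supported on constant functions, for which the quotient is \<open>0 / 0\<close>;
  HOL would evaluate it to \<open>0\<close>, making them spurious minimizers.
\<close>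

definition admissible :: "nat \<Rightarrow> real \<Rightarrow> ((nat \<Rightarrow> int) \<Rightarrow> int) pmf \<Rightarrow> bool" where
  "admissible d \<beta> H \<longleftrightarrow>
     set_pmf H \<subseteq> boolean_functions d \<and> ln (1 / collision_prob d \<beta> H) \<noteq> 0"

definition dictator :: "nat \<Rightarrow> ((nat \<Rightarrow> int) \<Rightarrow> int) \<Rightarrow> bool" where
  "dictator d h \<longleftrightarrow>
     h \<in> boolean_functions d \<and>
     (\<exists>i\<in>{1..d}. (\<forall>x\<in>cube d. h x = x i) \<or> (\<forall>x\<in>cube d. h x = - x i))"

end

theory Submission
  imports Defs
begin

text \<open>
  The density of a correlated pair is a product of factors
  \<open>(1 + \<alpha> x\<^sub>i y\<^sub>i) / 4\<close>; expanding it shows that the collision probability is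
  \<open>\<Sum>\<^sub>S w\<^sub>S (1 + \<alpha>\<^bsup>|S|\<^esup>) / 2\<close>, where the weights \<open>w\<^sub>S\<close> are the averaged squared
  Fourier coefficients and sum to \<open>1\<close>. Let \<open>s\<close> be the value of \<open>rho\<close> on a dictator, so that
  \<open>(1 + \<alpha>) / 2 = ((1 + \<beta>) / 2)\<^sup>s\<close>. Then \<open>(1 + \<alpha>\<^sup>k) / 2 \<le> ((1 + \<beta>\<^sup>k) / 2)\<^sup>s\<close> for all \<open>k\<close>, strictly
  for \<open>k \<ge> 2\<close>, and concavity of \<open>u \<mapsto> u\<^sup>s\<close> carries this over to the mixture; strictness is lost only
  if all weight sits on level \<open>1\<close>. A Boolean function with all its weight on level \<open>1\<close> is linear,
  and flipping one coordinate shows that its coefficients lie in \<open>{-1, 0, 1}\<close>.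
\<close>

section \<open>The inequality between collision probabilities\<close>

lemma ln_less_minus_one:
  fixes x :: real
  assumes "0 < x" "x \<noteq> 1"
  shows "ln x < x - 1"
  using ln_le_minus_one[of x] ln_eq_minus_one[of x] assms by linarith

text \<open>Let \<open>m\<close> be the mean of \<open>u\<close> and 1 with weights \<open>s\<close>
  and \<open>1 - s\<close>, and apply \<open>ln z \<le> z - 1\<close> at \<open>u / m\<close> and
  \<open>1 / m\<close>. The weighted right-hand sides cancel because \<open>m\<close> is the mean,
  and \<open>m \<noteq> 1\<close> makes the second bound strict.\<close>

lemma Bernoulli_powr_strict:
  fixes u s :: real
  assumes "0 < u" "u \<noteq> 1" "0 < s" "s < 1"
  shows "u powr s < 1 + s * (u - 1)"
proof -
  define m where "m = 1 + s * (u - 1)"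
  have m: "m = s * u + (1 - s)" by (simp add: m_def algebra_simps)
  have m0: "m > 0" unfolding m using assms by (intro add_pos_pos mult_pos_pos) auto
  have m1: "m \<noteq> 1" using assms by (simp add: m_def)
  have "s * ln (u / m) \<le> s * (u / m - 1)"
    using ln_le_minus_one[of "u / m"] assms m0 by (intro mult_left_mono) auto
  moreover have "(1 - s) * ln (1 / m) < (1 - s) * (1 / m - 1)"
    using ln_less_minus_one[of "1 / m"] assms m0 m1 by (intro mult_strict_left_mono) auto
  moreover have "s * ln (u / m) + (1 - s) * ln (1 / m) = s * ln u - ln m"
    using assms m0 by (simp add: ln_div algebra_simps)
  moreover have "s * (u / m - 1) + (1 - s) * (1 / m - 1) = 0"
    using m0 by (simp add: field_simps) (simp add: m algebra_simps)
  ultimately have "s * ln u < ln m" by linarith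
  then have "exp (s * ln u) < m" using m0 by (metis exp_less_cancel_iff exp_ln)
  then show ?thesis using assms by (simp add: powr_def m_def)
qed

lemma Bernoulli_powr:
  fixes u s :: real
  assumes "0 < u" "0 < s" "s < 1"
  shows "u powr s \<le> 1 + s * (u - 1)"
  using Bernoulli_powr_strict[of u s] assms by (cases "u = 1") auto

text \<open>The constant \<open>c\<close> makes \<open>F\<close> vanish at \<beta>, and
  \<open>F 1 = 0\<close> as well. If \<open>F\<close> were nonnegative at \<alpha>, the mean value
  theorem would give points \<open>a < \<alpha> < b\<close> with derivative nonnegative at
  \<open>a\<close> and nonpositive at \<open>b\<close>. But the derivative has the sign of
  \<open>k * R t - c\<close>, and \<open>R\<close> increases strictly on [0,1] once
  \<open>k \<ge> 2\<close>.\<close>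

lemma ln_noise_ratio_strict:
  fixes \<alpha> \<beta> :: real and k :: nat
  assumes "0 \<le> \<beta>" "\<beta> < \<alpha>" "\<alpha> < 1" "2 \<le> k"
  shows "ln ((1 + \<alpha> ^ k) / 2) < ln ((1 + \<alpha>) / 2) / ln ((1 + \<beta>) / 2) * ln ((1 + \<beta> ^ k) / 2)"
proof (rule ccontr)
  define c where "c = ln ((1 + \<beta> ^ k) / 2) / ln ((1 + \<beta>) / 2)"
  define F where "F t = ln ((1 + t ^ k) / 2) - c * ln ((1 + t) / 2)" for t :: real
  \<comment> \<open>In this form monotonicity on [0,1] is visible: as \<open>t\<close> grows, the
    numerator of the subtracted quotient falls and its denominator rises.\<close>
  define R where "R t = 1 - (1 - t ^ (k - 1)) / (1 + t ^ k)" for t :: real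
  assume "\<not> ?thesis"
  then have F\<alpha>: "F \<alpha> \<ge> 0" by (simp add: F_def c_def mult.commute)
  have "ln ((1 + \<beta>) / 2) \<noteq> 0" using assms by simp
  then have F\<beta>: "F \<beta> = 0" by (simp add: F_def c_def)
  have F1: "F 1 = 0" by (simp add: F_def)
  have deriv: "(F has_real_derivative k * t ^ (k - 1) / (1 + t ^ k) - c / (1 + t)) (at t)"
    if "0 \<le> t" for t :: real
  proof -
    have "1 + t ^ k > 0" using that by (simp add: add_pos_nonneg)
    \<comment> \<open>Cancels the factors of 2 left over from differentiating the two
      logarithms.\<close>
    moreover have "2 * u / (2 + v * 2) = u / (1 + v)" for u v :: real
      using mult_divide_mult_cancel_left[of 2 u "1 + v"] by (simp add: mult.commute)
    ultimately show ?thesis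
      unfolding F_def using that by (auto intro!: derivative_eq_intros)
  qed
  have R: "k * t ^ (k - 1) / (1 + t ^ k) - c / (1 + t) = (k * R t - c) / (1 + t)"
    if "0 \<le> t" for t :: real
  proof -
    have pos: "1 + t ^ k > 0" using that by (simp add: add_pos_nonneg)
    have "t ^ k = t * t ^ (k - 1)" using assms by (simp flip: power_Suc)
    then have "R t = (1 + t) * t ^ (k - 1) / (1 + t ^ k)"
      using pos by (simp add: R_def field_simps)
    then show ?thesis using that pos by (simp add: divide_simps) (simp add: algebra_simps)
  qed
  obtain a where a: "\<beta> < a" "a < \<alpha>" "F \<alpha> - F \<beta> = (\<alpha> - \<beta>) * ((k * R a - c) / (1 + a))"
    using MVT2[of \<beta> \<alpha> F "\<lambda>t. (k * R t - c) / (1 + t)"] assms deriv R by auto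
  obtain b where b: "\<alpha> < b" "b < 1" "F 1 - F \<alpha> = (1 - \<alpha>) * ((k * R b - c) / (1 + b))"
    using MVT2[of \<alpha> 1 F "\<lambda>t. (k * R t - c) / (1 + t)"] assms deriv R by auto
  have "0 \<le> (\<alpha> - \<beta>) * ((k * R a - c) / (1 + a))" using a F\<alpha> F\<beta> by simp
  then have "c \<le> k * R a"
    using assms a by (auto simp: zero_le_mult_iff zero_le_divide_iff)
  moreover have "(1 - \<alpha>) * ((k * R b - c) / (1 + b)) \<le> 0" using b F\<alpha> F1 by simp
  then have "k * R b \<le> c"
    using assms b by (auto simp: mult_le_0_iff divide_le_0_iff)
  moreover have "R a < R b"
  proof -
    have ab: "0 \<le> a" "a < b" using a b assms by auto
    have "a ^ (k - 1) < b ^ (k - 1)" "a ^ k < b ^ k"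
      using ab assms by (auto intro!: power_strict_mono)
    moreover have "b ^ (k - 1) < 1 ^ (k - 1)"
      using b ab assms by (intro power_strict_mono) auto
    then have "b ^ (k - 1) < 1" by simp
    moreover have "0 \<le> a ^ k" using ab by simp
    ultimately have "(1 - b ^ (k - 1)) / (1 + b ^ k) < (1 - a ^ (k - 1)) / (1 + a ^ k)"
      by (intro frac_less2) auto
    then show ?thesis by (simp add: R_def)
  qed
  then have "k * R a < k * R b" using assms by simp
  ultimately show False by linarith
qed

lemma noise_powr_strict:
  fixes \<alpha> \<beta> :: real and k :: nat
  assumes "0 \<le> \<beta>" "\<beta> < \<alpha>" "\<alpha> < 1" "2 \<le> k"
  shows "(1 + \<alpha> ^ k) / 2 < ((1 + \<beta> ^ k) / 2) powr (ln ((1 + \<alpha>) / 2) / ln ((1 + \<beta>) / 2))"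
proof -
  have pos: "(1 + \<alpha> ^ k) / 2 > 0" "(1 + \<beta> ^ k) / 2 > 0"
    using assms by (auto simp: add_pos_nonneg)
  then have "(1 + \<alpha> ^ k) / 2 = exp (ln ((1 + \<alpha> ^ k) / 2))" by simp
  also have "\<dots> < exp (ln ((1 + \<alpha>) / 2) / ln ((1 + \<beta>) / 2) * ln ((1 + \<beta> ^ k) / 2))"
    using ln_noise_ratio_strict[OF assms] by simp
  finally show ?thesis using pos by (simp add: powr_def)
qed

text \<open>Levels 0 and 1 give equality: at 0 both sides are 1, and the exponent is chosen to match
  them at 1.\<close>

lemma noise_powr:
  fixes \<alpha> \<beta> :: real and k :: nat
  assumes "0 \<le> \<beta>" "\<beta> < \<alpha>" "\<alpha> < 1"
  shows "(1 + \<alpha> ^ k) / 2 \<le> ((1 + \<beta> ^ k) / 2) powr (ln ((1 + \<alpha>) / 2) / ln ((1 + \<beta>) / 2))"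
proof -
  consider "k = 0" | "k = 1" | "k \<ge> 2" by linarith
  then show ?thesis
  proof cases
    case 2
    have "ln ((1 + \<beta>) / 2) \<noteq> 0" using assms by simp
    then show ?thesis using 2 assms by (simp add: powr_def)
  next
    case 3
    then show ?thesis using noise_powr_strict[OF assms, of k] by simp
  qed auto
qed

section \<open>From single levels to mixtures of levels\<close>

lemma mixture_ge_half:
  fixes w :: "'a \<Rightarrow> real" and n :: "'a \<Rightarrow> nat" and t :: real
  assumes "finite A" "\<And>a. a \<in> A \<Longrightarrow> 0 \<le> w a" "(\<Sum>a\<in>A. w a) = 1" "0 \<le> t"
  shows "1 / 2 \<le> (\<Sum>a\<in>A. w a * ((1 + t ^ n a) / 2))"
proof -
  have "1 / 2 = (\<Sum>a\<in>A. w a * (1 / 2))" using assms by (simp flip: sum_divide_distrib)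
  also have "\<dots> \<le> (\<Sum>a\<in>A. w a * ((1 + t ^ n a) / 2))"
    using assms by (intro sum_mono mult_left_mono) auto
  finally show ?thesis .
qed

lemma mixture_ln_ratio_strict:
  fixes A :: "'a set" and w :: "'a \<Rightarrow> real" and n :: "'a \<Rightarrow> nat" and \<alpha> \<beta> :: real
  defines "P t \<equiv> \<Sum>a\<in>A. w a * ((1 + t ^ n a) / 2)"
  assumes A: "finite A" "\<And>a. a \<in> A \<Longrightarrow> 0 \<le> w a" "(\<Sum>a\<in>A. w a) = 1"
    and \<alpha>\<beta>: "0 \<le> \<beta>" "\<beta> < \<alpha>" "\<alpha> < 1"
    and "P \<beta> \<noteq> 1"
    and b: "b \<in> A" "w b \<noteq> 0" "n b \<noteq> 1"
  shows "ln (P \<alpha>) < ln ((1 + \<alpha>) / 2) / ln ((1 + \<beta>) / 2) * ln (P \<beta>)"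
proof -
  define s where "s = ln ((1 + \<alpha>) / 2) / ln ((1 + \<beta>) / 2)"
  define x where "x a = (1 + \<beta> ^ n a) / 2" for a
  have lns: "ln ((1 + \<alpha>) / 2) < 0" "ln ((1 + \<beta>) / 2) < 0"
    "ln ((1 + \<beta>) / 2) < ln ((1 + \<alpha>) / 2)" using \<alpha>\<beta> by auto
  then have s: "0 < s" "s < 1" by (auto simp: s_def divide_less_eq zero_less_divide_iff)
  have x: "x a \<ge> 1 / 2" for a using \<alpha>\<beta> by (simp add: x_def)
  have half: "P t \<ge> 1 / 2" if "0 \<le> t" for t
    unfolding P_def using A that by (rule mixture_ge_half)
  have pos: "P \<alpha> > 0" "P \<beta> > 0" using half[of \<alpha>] half[of \<beta>] \<alpha>\<beta> by auto
  \<comment> \<open>The tangent to \<open>u powr s\<close> at \<open>u = P \<beta>\<close> lies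
    above this concave function; it is Bernoulli's inequality rescaled by
    \<open>P \<beta>\<close>.\<close>
  have tangent: "x a powr s \<le> P \<beta> powr s * (1 + s * (x a / P \<beta> - 1))" for a
  proof -
    have "x a powr s = P \<beta> powr s * (x a / P \<beta>) powr s"
      using pos x[of a] by (simp add: powr_divide)
    then show ?thesis using Bernoulli_powr[of "x a / P \<beta>" s] s pos x[of a] by simp
  qed
  have le: "(1 + \<alpha> ^ n a) / 2 \<le> P \<beta> powr s * (1 + s * (x a / P \<beta> - 1))" for a
    using order_trans[OF noise_powr[OF \<alpha>\<beta>, of "n a", folded s_def] tangent[of a, unfolded x_def]]
    unfolding x_def .
  \<comment> \<open>Strictness has two sources. At level 0 the noise inequality is an equality, but
    the tangent bound is strict since \<open>x b = 1\<close> differs from the point of tangency. At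
    level 2 or higher the noise inequality itself is strict.\<close>
  have less: "(1 + \<alpha> ^ n b) / 2 < P \<beta> powr s * (1 + s * (x b / P \<beta> - 1))"
  proof (cases "n b = 0")
    case True
    have "1 / P \<beta> \<noteq> 1" using \<open>P \<beta> \<noteq> 1\<close> pos by simp
    then have "(1 / P \<beta>) powr s < 1 + s * (1 / P \<beta> - 1)"
      using s pos by (intro Bernoulli_powr_strict) auto
    then have "P \<beta> powr s * (1 / P \<beta>) powr s < P \<beta> powr s * (1 + s * (1 / P \<beta> - 1))"
      using pos by (intro mult_strict_left_mono) auto
    then show ?thesis using True pos by (simp add: x_def powr_divide)
  next
    case False
    then have "2 \<le> n b" using b by linarith
    from less_le_trans[OF noise_powr_strict[OF \<alpha>\<beta> this, folded s_def] tangent[of b, unfolded x_def]]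
    show ?thesis unfolding x_def .
  qed
  have "P \<alpha> < (\<Sum>a\<in>A. w a * (P \<beta> powr s * (1 + s * (x a / P \<beta> - 1))))"
    unfolding P_def[of \<alpha>]
  proof (rule sum_strict_mono_ex1)
    show "\<exists>a\<in>A. w a * ((1 + \<alpha> ^ n a) / 2) < w a * (P \<beta> powr s * (1 + s * (x a / P \<beta> - 1)))"
      using b A(2)[of b] less by (intro bexI[of _ b] mult_strict_left_mono) auto
    show "\<forall>a\<in>A. w a * ((1 + \<alpha> ^ n a) / 2) \<le> w a * (P \<beta> powr s * (1 + s * (x a / P \<beta> - 1)))"
      by (intro ballI mult_left_mono le A(2))
  qed (rule A(1))
  \<comment> \<open>An affine function averages to its value at the mean; the mean of
    \<open>x\<close> is \<open>P \<beta>\<close>, so the linear correction drops out.\<close>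
  also have "\<dots> = (\<Sum>a\<in>A. P \<beta> powr s * ((1 - s) * w a + s * (w a * x a / P \<beta>)))"
    by (intro sum.cong) (auto simp: algebra_simps)
  also have "\<dots> = P \<beta> powr s * ((1 - s) * (\<Sum>a\<in>A. w a) + s * ((\<Sum>a\<in>A. w a * x a) / P \<beta>))"
    by (simp only: sum_distrib_left sum_divide_distrib sum.distrib distrib_left)
  also have "(\<Sum>a\<in>A. w a * x a) = P \<beta>" by (simp add: P_def x_def)
  finally have "P \<alpha> < P \<beta> powr s" using A pos by simp
  then have "ln (P \<alpha>) < ln (P \<beta> powr s)" using pos by (subst ln_less_cancel_iff) auto
  then show ?thesis using pos by (simp add: s_def ln_powr)
qed

section \<open>Fourier analysis on the cube\<close>

lemma finite_cube: "finite (cube d)"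
  by (simp add: cube_def finite_PiE)

lemma card_cube: "card (cube d) = 2 ^ d"
  by (simp add: cube_def card_PiE numeral_2_eq_2)

lemma cube_nonempty: "cube d \<noteq> {}"
  using card_cube[of d] by force

lemma cube_cases: "x \<in> cube d \<Longrightarrow> i \<in> {1..d} \<Longrightarrow> x i = 1 \<or> x i = - 1"
  unfolding cube_def by (metis PiE_mem empty_iff insert_iff)

lemma cube_mult_self: "x \<in> cube d \<Longrightarrow> i \<in> {1..d} \<Longrightarrow> real_of_int (x i) * real_of_int (x i) = 1"
  using cube_cases by fastforce

lemma finite_boolean_functions: "finite (boolean_functions d)"
  by (simp add: boolean_functions_def finite_PiE finite_cube)

lemma boolean_functions_cases: "h \<in> boolean_functions d \<Longrightarrow> x \<in> cube d \<Longrightarrow> h x = 1 \<or> h x = - 1"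
  unfolding boolean_functions_def by (metis PiE_mem empty_iff insert_iff)

lemma boolean_functions_mult_self:
  "h \<in> boolean_functions d \<Longrightarrow> x \<in> cube d \<Longrightarrow> real_of_int (h x) * real_of_int (h x) = 1"
  using boolean_functions_cases by fastforce

text \<open>The Walsh character of \<open>S\<close>.\<close>

definition chi :: "nat set \<Rightarrow> (nat \<Rightarrow> int) \<Rightarrow> real" where
  "chi S x = (\<Prod>i\<in>S. real_of_int (x i))"

definition fourier_coeff :: "nat \<Rightarrow> ((nat \<Rightarrow> int) \<Rightarrow> int) \<Rightarrow> nat set \<Rightarrow> real" where
  "fourier_coeff d h S = (\<Sum>x\<in>cube d. real_of_int (h x) * chi S x) / 2 ^ d"

text \<open>On the cube this is the conditional probability of \<open>y\<close> given
  \<open>x\<close>: each factor is \<open>(1 + \<alpha>) / 2\<close> at an agreeing coordinate and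
  \<open>(1 - \<alpha>) / 2\<close> at a disagreeing one.\<close>

definition noise_kernel :: "nat \<Rightarrow> real \<Rightarrow> (nat \<Rightarrow> int) \<Rightarrow> (nat \<Rightarrow> int) \<Rightarrow> real" where
  "noise_kernel d \<alpha> x y = (\<Prod>i\<in>{1..d}. (1 + \<alpha> * real_of_int (x i) * real_of_int (y i)) / 2)"

text \<open>Multiply out the product: \<open>S\<close> records the coordinates at which the
  non-constant term of the factor is chosen.\<close>

lemma noise_kernel_eq_sum_chi:
  "noise_kernel d \<alpha> x y = (\<Sum>S\<in>Pow {1..d}. \<alpha> ^ card S * chi S x * chi S y) / 2 ^ d"
proof -
  have "noise_kernel d \<alpha> x y =
      (\<Prod>i\<in>{1..d}. \<alpha> * real_of_int (x i) * real_of_int (y i) + 1) / 2 ^ d"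
    by (simp add: noise_kernel_def prod_dividef add.commute)
  also have "\<dots> = (\<Sum>S\<in>Pow {1..d}. \<alpha> ^ card S * chi S x * chi S y) / 2 ^ d"
    by (subst prod_add) (simp_all add: chi_def prod.distrib)
  finally show ?thesis .
qed

text \<open>A single disagreeing coordinate contributes the factor 0. Combined with the character
  expansion, this is the completeness relation of the Walsh characters; it yields both Parseval and
  inversion without a separate orthogonality computation.\<close>

lemma noise_kernel_one:
  assumes "x \<in> cube d" "y \<in> cube d"
  shows "noise_kernel d 1 x y = (if x = y then 1 else 0)"
proof (cases "x = y")
  case True
  then show ?thesis unfolding noise_kernel_def
    using cube_mult_self[OF assms(1)] by (auto intro!: prod.neutral)
next
  case False
  then obtain i where i: "i \<in> {1..d}" "x i \<noteq> y i"
    using assms unfolding cube_def by (meson PiE_ext)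
  then have "x i = - y i" using cube_cases[OF assms(1), of i] cube_cases[OF assms(2), of i] by auto
  moreover have "y i = 1 \<or> y i = - 1" using cube_cases[OF assms(2)] i by blast
  ultimately have "\<exists>i\<in>{1..d}. (1 + 1 * real_of_int (x i) * real_of_int (y i)) / 2 = 0"
    using i by (intro bexI[of _ i]) auto
  then show ?thesis using False unfolding noise_kernel_def by (simp add: prod_zero)
qed

text \<open>After the kernel is expanded and the sum over \<open>S\<close> moved outside, the double
  sum for each \<open>S\<close> factors into two copies of the same Fourier coefficient.\<close>

lemma noise_stability:
  "(\<Sum>x\<in>cube d. \<Sum>y\<in>cube d. noise_kernel d \<alpha> x y * h x * h y) / 2 ^ d
     = (\<Sum>S\<in>Pow {1..d}. \<alpha> ^ card S * (fourier_coeff d h S)\<^sup>2)"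
proof -
  have "(\<Sum>x\<in>cube d. \<Sum>y\<in>cube d. noise_kernel d \<alpha> x y * h x * h y) / 2 ^ d
      = (\<Sum>x\<in>cube d. \<Sum>y\<in>cube d. \<Sum>S\<in>Pow {1..d}.
          \<alpha> ^ card S * (h x * chi S x / 2 ^ d) * (h y * chi S y / 2 ^ d))"
    by (simp add: noise_kernel_eq_sum_chi sum_distrib_left sum_distrib_right sum_divide_distrib mult_ac)
  also have "\<dots> = (\<Sum>S\<in>Pow {1..d}. \<Sum>x\<in>cube d. \<Sum>y\<in>cube d.
          \<alpha> ^ card S * (h x * chi S x / 2 ^ d) * (h y * chi S y / 2 ^ d))"
    by (subst sum.swap[of _ "Pow {1..d}"], subst sum.swap[of _ "Pow {1..d}"]) simp
  also have "\<dots> = (\<Sum>S\<in>Pow {1..d}. \<alpha> ^ card S * (fourier_coeff d h S)\<^sup>2)"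
    by (simp add: fourier_coeff_def power2_eq_square sum_product sum_distrib_left sum_divide_distrib mult_ac)
  finally show ?thesis .
qed

text \<open>Noise stability at correlation 1, where only the diagonal \<open>x = y\<close> survives
  and \<open>h\<close> squares to 1.\<close>

lemma parseval:
  assumes "h \<in> boolean_functions d"
  shows "(\<Sum>S\<in>Pow {1..d}. (fourier_coeff d h S)\<^sup>2) = 1"
proof -
  have "(\<Sum>S\<in>Pow {1..d}. (fourier_coeff d h S)\<^sup>2)
      = (\<Sum>x\<in>cube d. \<Sum>y\<in>cube d. noise_kernel d 1 x y * h x * h y) / 2 ^ d"
    by (simp add: noise_stability)
  also have "(\<Sum>x\<in>cube d. \<Sum>y\<in>cube d. noise_kernel d 1 x y * h x * h y)
      = (\<Sum>x\<in>cube d. \<Sum>y\<in>cube d. if x = y then real_of_int (h x * h x) else 0)"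
    by (intro sum.cong) (auto simp: noise_kernel_one)
  also have "\<dots> = (\<Sum>x\<in>cube d. 1)"
    using boolean_functions_mult_self[OF assms] by (intro sum.cong) (auto simp: finite_cube)
  finally show ?thesis by (simp add: card_cube)
qed

lemma fourier_inversion:
  assumes "x \<in> cube d"
  shows "real_of_int (h x) = (\<Sum>S\<in>Pow {1..d}. fourier_coeff d h S * chi S x)"
proof -
  have "real_of_int (h x) = (\<Sum>y\<in>cube d. if x = y then real_of_int (h y) else 0)"
    using assms by (simp add: finite_cube)
  also have "\<dots> = (\<Sum>y\<in>cube d. h y * noise_kernel d 1 x y)"
    using assms by (intro sum.cong) (auto simp: noise_kernel_one)
  also have "\<dots> = (\<Sum>S\<in>Pow {1..d}. fourier_coeff d h S * chi S x)"
    by (simp add: noise_kernel_eq_sum_chi fourier_coeff_def sum_distrib_left sum_distrib_right sum_divide_distrib mult_ac)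
      (rule sum.swap)
  finally show ?thesis .
qed

section \<open>Collision probabilities\<close>

lemma pmf_correlated_pair:
  assumes "0 \<le> \<alpha>" "\<alpha> \<le> 1" "x \<in> cube d" "y \<in> cube d"
  shows "pmf (correlated_pair d \<alpha>) (x, y) = noise_kernel d \<alpha> x y / 2 ^ d"
proof -
  define K where "K x = Pi_pmf {1..d} undefined
      (\<lambda>i. map_pmf (\<lambda>b. if b then x i else - x i) (bernoulli_pmf ((1 + \<alpha>) / 2)))"
    for x :: "nat \<Rightarrow> int"
  have factor: "pmf (map_pmf (\<lambda>b. if b then x i else - x i) (bernoulli_pmf ((1 + \<alpha>) / 2))) (y i)
      = (1 + \<alpha> * real_of_int (x i) * real_of_int (y i)) / 2" if i: "i \<in> {1..d}" for i
  proof -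
    have xi: "x i = 1 \<or> x i = - 1" and yi: "y i = 1 \<or> y i = - 1"
      using cube_cases i assms by blast+
    have inj: "inj (\<lambda>b. if b then x i else - x i)" using xi by (auto simp: inj_def)
    \<comment> \<open>Presents \<open>y i\<close> as the image of the truth value
      \<open>y i = x i\<close>, so that the mass of an injective image applies.\<close>
    have y: "y i = (if y i = x i then x i else - x i)" using xi yi by auto
    have "pmf (map_pmf (\<lambda>b. if b then x i else - x i) (bernoulli_pmf ((1 + \<alpha>) / 2))) (y i)
        = pmf (bernoulli_pmf ((1 + \<alpha>) / 2)) (y i = x i)"
      by (subst y, rule pmf_map_inj'[OF inj])
    also have "\<dots> = (1 + \<alpha> * real_of_int (x i) * real_of_int (y i)) / 2"
      using xi yi assms by (cases "y i = x i") (auto simp: field_simps)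
    finally show ?thesis .
  qed
  have "correlated_pair d \<alpha> = pmf_of_set (cube d) \<bind> (\<lambda>x. map_pmf (Pair x) (K x))"
    by (simp add: correlated_pair_def K_def map_pmf_def)
  then have "pmf (correlated_pair d \<alpha>) (x, y)
      = (\<Sum>x'\<in>cube d. pmf (map_pmf (Pair x') (K x')) (x, y)) / 2 ^ d"
    by (simp add: pmf_bind_pmf_of_set cube_nonempty finite_cube card_cube)
  also have "(\<Sum>x'\<in>cube d. pmf (map_pmf (Pair x') (K x')) (x, y))
      = (\<Sum>x'\<in>cube d. if x' = x then pmf (K x) y else 0)"
  proof (intro sum.cong refl)
    fix x'
    show "pmf (map_pmf (Pair x') (K x')) (x, y) = (if x' = x then pmf (K x) y else 0)"
    proof (cases "x' = x")
      case True
      then show ?thesis by (simp add: pmf_map_inj' inj_def)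
    next
      case False
      then have "(x, y) \<notin> set_pmf (map_pmf (Pair x') (K x'))" by auto
      then show ?thesis using False by (simp add: pmf_eq_0_set_pmf)
    qed
  qed
  also have "\<dots> = pmf (K x) y" using assms by (simp add: finite_cube)
  also have "\<dots> = noise_kernel d \<alpha> x y"
  proof -
    \<comment> \<open>\<open>Pi_pmf\<close> puts its mass on functions with the default value off
      the index set; here that default agrees with the extensionality of the cube.\<close>
    have "y i = undefined" if "i \<notin> {1..d}" for i
      using PiE_arb[OF assms(4)[unfolded cube_def] that] .
    then have "pmf (K x) y = (\<Prod>i\<in>{1..d}. pmf (map_pmf (\<lambda>b. if b then x i else - x i)
        (bernoulli_pmf ((1 + \<alpha>) / 2))) (y i))"
      unfolding K_def by (intro pmf_Pi') auto
    also have "\<dots> = noise_kernel d \<alpha> x y"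
      unfolding noise_kernel_def by (intro prod.cong refl factor)
    finally show ?thesis .
  qed
  finally show ?thesis .
qed

lemma set_pmf_correlated_pair: "set_pmf (correlated_pair d \<alpha>) \<subseteq> cube d \<times> cube d"
proof -
  have "y \<in> cube d" if "x \<in> cube d" and "y \<in> set_pmf (Pi_pmf {1..d} undefined
      (\<lambda>i. map_pmf (\<lambda>b. if b then x i else - x i) (bernoulli_pmf ((1 + \<alpha>) / 2))))" for x y
  proof -
    have "y i \<in> {-1, 1}" if "i \<in> {1..d}" for i
    proof -
      have "y i = x i \<or> y i = - x i"
        using \<open>y \<in> _\<close> that by (auto simp: set_Pi_pmf PiE_dflt_def split: if_splits)
      then show ?thesis using cube_cases[OF \<open>x \<in> cube d\<close> that] by auto
    qed
    moreover have "y i = undefined" if "i \<notin> {1..d}" for i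
      using \<open>y \<in> _\<close> that unfolding set_Pi_pmf[OF finite_atLeastAtMost] PiE_dflt_def by auto
    ultimately show ?thesis unfolding cube_def by (intro PiE_I) auto
  qed
  then show ?thesis
    by (auto simp: correlated_pair_def cube_nonempty finite_cube)
qed

text \<open>For \<open>H\<close> supported on Boolean functions this is an expectation; as a finite
  sum it can be exchanged with the sum over \<open>S\<close>.\<close>

definition fourier_weight :: "nat \<Rightarrow> ((nat \<Rightarrow> int) \<Rightarrow> int) pmf \<Rightarrow> nat set \<Rightarrow> real" where
  "fourier_weight d H S = (\<Sum>h\<in>boolean_functions d. pmf H h * (fourier_coeff d h S)\<^sup>2)"

lemma fourier_weight_nonneg: "0 \<le> fourier_weight d H S"
  by (simp add: fourier_weight_def sum_nonneg)

lemma sum_fourier_weight: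
  assumes "set_pmf H \<subseteq> boolean_functions d"
  shows "(\<Sum>S\<in>Pow {1..d}. fourier_weight d H S) = 1"
proof -
  have "(\<Sum>S\<in>Pow {1..d}. fourier_weight d H S)
      = (\<Sum>h\<in>boolean_functions d. pmf H h * (\<Sum>S\<in>Pow {1..d}. (fourier_coeff d h S)\<^sup>2))"
    unfolding fourier_weight_def by (subst sum.swap) (simp add: sum_distrib_left)
  also have "\<dots> = (\<Sum>h\<in>boolean_functions d. pmf H h)" by (simp add: parseval del: One_nat_def)
  also have "\<dots> = 1" by (rule sum_pmf_eq_1[OF finite_boolean_functions assms])
  finally show ?thesis .
qed

text \<open>For values in {-1, 1} the indicator of \<open>h x = h y\<close> is
  \<open>(1 + h x * h y) / 2\<close>. The constant part contributes the total mass of the correlated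
  pair, the product part the noise stability of \<open>h\<close>.\<close>

lemma collision_prob_eq:
  assumes "0 \<le> \<alpha>" "\<alpha> \<le> 1" "set_pmf H \<subseteq> boolean_functions d"
  shows "collision_prob d \<alpha> H
      = (\<Sum>S\<in>Pow {1..d}. fourier_weight d H S * ((1 + \<alpha> ^ card S) / 2))"
proof -
  let ?C = "correlated_pair d \<alpha>"
  have C: "(\<Sum>x\<in>cube d. \<Sum>y\<in>cube d. pmf ?C (x, y)) = 1"
    using sum_pmf_eq_1[OF _ set_pmf_correlated_pair, of d \<alpha>]
    by (simp add: finite_cube sum.cartesian_product)
  have stab: "(\<Sum>x\<in>cube d. \<Sum>y\<in>cube d. pmf ?C (x, y) * h x * h y)
      = (\<Sum>S\<in>Pow {1..d}. \<alpha> ^ card S * (fourier_coeff d h S)\<^sup>2)" for h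
    unfolding noise_stability[symmetric] sum_divide_distrib
    using assms by (intro sum.cong refl) (simp add: pmf_correlated_pair)
  have "collision_prob d \<alpha> H
      = measure_pmf.prob (pair_pmf H ?C) {z \<in> boolean_functions d \<times> cube d \<times> cube d. fst z (fst (snd z)) = fst z (snd (snd z))}"
    unfolding collision_prob_def using assms(3) set_pmf_correlated_pair[of d \<alpha>]
    by (intro measure_prob_cong_0) (auto simp: pmf_eq_0_set_pmf)
  also have "\<dots> = (\<Sum>z\<in>boolean_functions d \<times> cube d \<times> cube d.
      if fst z (fst (snd z)) = fst z (snd (snd z)) then pmf (pair_pmf H ?C) z else 0)"
    by (subst measure_measure_pmf_finite)
      (auto simp: finite_boolean_functions finite_cube sum.inter_filter)
  also have "\<dots> = (\<Sum>h\<in>boolean_functions d. \<Sum>x\<in>cube d. \<Sum>y\<in>cube d.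
      if h x = h y then pmf H h * pmf ?C (x, y) else 0)"
    by (auto simp: sum.cartesian_product pmf_pair intro!: sum.cong)
  also have "\<dots> = (\<Sum>h\<in>boolean_functions d. \<Sum>x\<in>cube d. \<Sum>y\<in>cube d.
      pmf H h * (pmf ?C (x, y) + pmf ?C (x, y) * h x * h y) / 2)"
  proof (intro sum.cong refl)
    fix h x y assume "h \<in> boolean_functions d" "x \<in> cube d" "y \<in> cube d"
    then have "h x = 1 \<or> h x = - 1" "h y = 1 \<or> h y = - 1"
      using boolean_functions_cases by blast+
    then show "(if h x = h y then pmf H h * pmf ?C (x, y) else 0)
        = pmf H h * (pmf ?C (x, y) + pmf ?C (x, y) * h x * h y) / 2"
      by auto
  qed
  also have "\<dots> = (\<Sum>h\<in>boolean_functions d. pmf H h *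
      ((\<Sum>x\<in>cube d. \<Sum>y\<in>cube d. pmf ?C (x, y)) + (\<Sum>x\<in>cube d. \<Sum>y\<in>cube d. pmf ?C (x, y) * h x * h y)) / 2)"
    by (simp add: sum_distrib_left sum_divide_distrib sum.distrib add_divide_distrib distrib_left)
  \<comment> \<open>The total mass 1 is rewritten as the Parseval sum, so that the two parts combine
    level by level.\<close>
  also have "\<dots> = (\<Sum>h\<in>boolean_functions d. pmf H h *
      ((\<Sum>S\<in>Pow {1..d}. (fourier_coeff d h S)\<^sup>2)
        + (\<Sum>S\<in>Pow {1..d}. \<alpha> ^ card S * (fourier_coeff d h S)\<^sup>2)) / 2)"
    by (intro sum.cong refl) (simp only: C stab parseval)
  also have "\<dots> = (\<Sum>h\<in>boolean_functions d. \<Sum>S\<in>Pow {1..d}.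
      pmf H h * (fourier_coeff d h S)\<^sup>2 * ((1 + \<alpha> ^ card S) / 2))"
    unfolding sum.distrib[symmetric] sum_distrib_left sum_divide_distrib
    by (intro sum.cong refl) (simp add: field_simps)
  also have "\<dots> = (\<Sum>S\<in>Pow {1..d}. fourier_weight d H S * ((1 + \<alpha> ^ card S) / 2))"
    unfolding fourier_weight_def sum_distrib_right by (rule sum.swap)
  finally show ?thesis .
qed

lemma collision_prob_ge_half:
  assumes "0 \<le> \<alpha>" "\<alpha> \<le> 1" "set_pmf H \<subseteq> boolean_functions d"
  shows "1 / 2 \<le> collision_prob d \<alpha> H"
  unfolding collision_prob_eq[OF assms]
  using assms by (intro mixture_ge_half) (auto simp: fourier_weight_nonneg sum_fourier_weight simp del: One_nat_def)

section \<open>Dictators\<close>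

text \<open>The comparison point for a minimizer. The coefficient at \<open>{1}\<close> is 1, so by
  Parseval all others vanish; \<open>restrict\<close> makes the function extensional, as membership
  in \<open>boolean_functions\<close> demands.\<close>

lemma collision_prob_dictator:
  assumes "0 \<le> \<alpha>" "\<alpha> \<le> 1" "d > 0"
  defines "h \<equiv> restrict (\<lambda>x. x 1) (cube d)"
  shows "h \<in> boolean_functions d" "collision_prob d \<alpha> (return_pmf h) = (1 + \<alpha>) / 2"
proof -
  have x1: "x 1 = 1 \<or> x 1 = - 1" if "x \<in> cube d" for x
    using cube_cases[OF that, of 1] assms by simp
  then show h: "h \<in> boolean_functions d"
    by (auto simp: h_def boolean_functions_def)
  have "(\<Sum>x\<in>cube d. real_of_int (h x) * chi {1} x) = (\<Sum>x\<in>cube d. 1)"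
    using cube_mult_self[of _ d 1] assms(3) by (intro sum.cong) (auto simp: h_def chi_def)
  then have c1: "fourier_coeff d h {1} = 1" by (simp add: fourier_coeff_def card_cube)
  have "(\<Sum>S\<in>Pow {1..d} - {{1}}. (fourier_coeff d h S)\<^sup>2) = 0"
    using parseval[OF h] assms c1 by (subst (asm) sum.remove[of _ "{1}"]) auto
  then have c0: "fourier_coeff d h S = 0" if "S \<in> Pow {1..d} - {{1}}" for S
    using that by (subst (asm) sum_nonneg_eq_0_iff) auto
  have w: "fourier_weight d (return_pmf h) S = (fourier_coeff d h S)\<^sup>2" for S
  proof -
    have "fourier_weight d (return_pmf h) S
        = (\<Sum>g\<in>boolean_functions d. if g = h then (fourier_coeff d h S)\<^sup>2 else 0)"
      unfolding fourier_weight_def by (intro sum.cong) (auto simp: indicator_def)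
    then show ?thesis using h by (simp add: finite_boolean_functions)
  qed
  have "collision_prob d \<alpha> (return_pmf h)
      = (\<Sum>S\<in>Pow {1..d}. (fourier_coeff d h S)\<^sup>2 * ((1 + \<alpha> ^ card S) / 2))"
    using collision_prob_eq[OF assms(1,2), of "return_pmf h" d] h by (simp add: w del: One_nat_def)
  also have "\<dots> = (1 + \<alpha>) / 2"
    using assms c1 c0 by (subst sum.remove[of _ "{1}"]) auto
  finally show "collision_prob d \<alpha> (return_pmf h) = (1 + \<alpha>) / 2" .
qed

text \<open>By inversion \<open>h\<close> is linear on the cube. Flipping coordinate
  \<open>i\<close> changes it by \<open>2 * a i * x i\<close> in absolute value 0 or 2, which
  confines \<open>a i\<close> to {-1, 0, 1}; Parseval then leaves exactly one nonzero
  coefficient.\<close>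

lemma level_one_imp_dictator:
  assumes h: "h \<in> boolean_functions d"
    and level: "\<And>S. S \<subseteq> {1..d} \<Longrightarrow> card S \<noteq> 1 \<Longrightarrow> fourier_coeff d h S = 0"
  shows "dictator d h"
proof -
  define a where "a i = fourier_coeff d h {i}" for i
  have singletons: "(\<Sum>S\<in>Pow {1..d}. f S) = (\<Sum>i\<in>{1..d}. f {i})"
    if "\<And>S. S \<subseteq> {1..d} \<Longrightarrow> card S \<noteq> 1 \<Longrightarrow> f S = 0" for f :: "nat set \<Rightarrow> real"
  proof -
    have "(\<Sum>S\<in>Pow {1..d}. f S) = (\<Sum>S\<in>(\<lambda>i. {i}) ` {1..d}. f S)"
      using that by (intro sum.mono_neutral_right) (auto simp: card_1_singleton_iff)
    then show ?thesis by (simp add: sum.reindex)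
  qed
  have linear: "real_of_int (h x) = (\<Sum>i\<in>{1..d}. a i * x i)" if "x \<in> cube d" for x
    unfolding fourier_inversion[OF that, of h]
    using level by (subst singletons) (auto simp: a_def chi_def)
  have norm: "(\<Sum>i\<in>{1..d}. (a i)\<^sup>2) = 1"
    using parseval[OF h] level by (subst (asm) singletons) (auto simp: a_def)
  have coeffs: "a i = 0 \<or> a i = 1 \<or> a i = - 1" if i: "i \<in> {1..d}" for i
  proof -
    obtain x where x: "x \<in> cube d" using cube_nonempty by blast
    define y where "y = x(i := - x i)"
    have "y j \<in> {-1, 1}" if "j \<in> {1..d}" for j
      using cube_cases[OF x that] by (cases "j = i") (auto simp: y_def)
    moreover have "y j = undefined" if "j \<notin> {1..d}" for j
      using PiE_arb[OF x[unfolded cube_def] that] that i by (cases "j = i") (auto simp: y_def)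
    ultimately have y: "y \<in> cube d" unfolding cube_def by (intro PiE_I)
    have "real_of_int (h x) - h y = (\<Sum>j\<in>{1..d}. a j * (real_of_int (x j) - y j))"
      unfolding linear[OF x] linear[OF y] by (simp add: sum_subtractf right_diff_distrib)
    also have "\<dots> = (\<Sum>j\<in>{1..d}. if j = i then 2 * a i * x i else 0)"
      by (intro sum.cong) (auto simp: y_def)
    also have "\<dots> = 2 * a i * x i" using i by simp
    finally show ?thesis
      using boolean_functions_cases[OF h x] boolean_functions_cases[OF h y] cube_cases[OF x i] by auto
  qed
  obtain i where i: "i \<in> {1..d}" "a i \<noteq> 0"
    using norm by (metis (no_types, lifting) power_zero_numeral sum.neutral zero_neq_one)
  have ai: "(a i)\<^sup>2 = 1" using coeffs[OF i(1)] i by auto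
  have "(\<Sum>j\<in>{1..d} - {i}. (a j)\<^sup>2) = 0"
    using norm i ai by (subst (asm) sum.remove[of _ i]) auto
  then have a0: "a j = 0" if "j \<in> {1..d} - {i}" for j
    using that by (subst (asm) sum_nonneg_eq_0_iff) auto
  have hx: "real_of_int (h x) = a i * x i" if "x \<in> cube d" for x
    unfolding linear[OF that] using i a0 by (subst sum.remove[of _ i]) auto
  from coeffs[OF i(1)] i(2) have "a i = 1 \<or> a i = - 1" by blast
  then have "(\<forall>x\<in>cube d. h x = x i) \<or> (\<forall>x\<in>cube d. h x = - x i)"
  proof
    assume "a i = 1"
    then show ?thesis using hx by simp
  next
    assume "a i = - 1"
    then have "real_of_int (h x) = real_of_int (- x i)" if "x \<in> cube d" for x
      using hx[OF that] by simp
    then show ?thesis by (metis of_int_eq_iff)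
  qed
  then show ?thesis using h i unfolding dictator_def by blast
qed

section \<open>Comparing a minimizer with a dictator\<close>

lemma rho_eq:
  assumes "0 < collision_prob d \<alpha> H" "0 < collision_prob d \<beta> H"
  shows "rho d \<alpha> \<beta> H = ln (collision_prob d \<alpha> H) / ln (collision_prob d \<beta> H)"
  using assms by (simp add: rho_def ln_div)

theorem theorem7p1:
  fixes d :: nat and \<alpha> \<beta> :: real and H :: "((nat \<Rightarrow> int) \<Rightarrow> int) pmf"
  assumes "d > 0"
    and "0 \<le> \<beta>" and "\<beta> < \<alpha>" and "\<alpha> < 1"
    and "is_arg_min (rho d \<alpha> \<beta>) (admissible d \<beta>) H"
  shows "\<forall>h. pmf H h \<noteq> 0 \<longrightarrow> dictator d h"
proof -
  define D where "D = return_pmf (restrict (\<lambda>x. x 1) (cube d) :: (nat \<Rightarrow> int) \<Rightarrow> int)"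
  define s where "s = ln ((1 + \<alpha>) / 2) / ln ((1 + \<beta>) / 2)"
  have D\<alpha>: "collision_prob d \<alpha> D = (1 + \<alpha>) / 2" and D\<beta>: "collision_prob d \<beta> D = (1 + \<beta>) / 2"
    using collision_prob_dictator[of _ d] assms by (auto simp: D_def)
  have "set_pmf D \<subseteq> boolean_functions d"
    using collision_prob_dictator(1)[of \<alpha> d] assms by (simp add: D_def)
  \<comment> \<open>The dictator is a legitimate competitor because \<open>(1 + \<beta>) / 2\<close>
    is positive and below 1, so its denominator is nonzero.\<close>
  then have "admissible d \<beta> D"
    using assms by (simp add: admissible_def D\<beta>)
  then have "\<not> rho d \<alpha> \<beta> D < rho d \<alpha> \<beta> H"
    using assms(5) by (auto simp: is_arg_min_def)
  moreover have "rho d \<alpha> \<beta> D = s"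
    using assms by (subst rho_eq) (simp_all add: D\<alpha> D\<beta> s_def)
  ultimately have min: "rho d \<alpha> \<beta> H \<le> s" by simp
  have H: "set_pmf H \<subseteq> boolean_functions d" "ln (1 / collision_prob d \<beta> H) \<noteq> 0"
    using assms(5) by (auto simp: is_arg_min_def admissible_def)
  have eq: "collision_prob d t H = (\<Sum>S\<in>Pow {1..d}. fourier_weight d H S * ((1 + t ^ card S) / 2))"
    if "0 \<le> t" "t < 1" for t using collision_prob_eq[of t H d] H that by simp
  have P\<beta>: "0 < collision_prob d \<beta> H" "collision_prob d \<beta> H < 1"
  proof -
    show "0 < collision_prob d \<beta> H"
      using collision_prob_ge_half[OF _ _ H(1), of \<beta>] assms by simp
    have "collision_prob d \<beta> H \<le> 1" by (simp add: collision_prob_def)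
    moreover have "collision_prob d \<beta> H \<noteq> 1" using H(2) by auto
    ultimately show "collision_prob d \<beta> H < 1" by linarith
  qed
  have w0: "fourier_weight d H S = 0" if "S \<subseteq> {1..d}" "card S \<noteq> 1" for S
  proof (rule ccontr)
    assume "fourier_weight d H S \<noteq> 0"
    then have "ln (collision_prob d \<alpha> H) < s * ln (collision_prob d \<beta> H)"
      using mixture_ln_ratio_strict[of "Pow {1..d}" "fourier_weight d H" \<beta> \<alpha> card S] that assms P\<beta>
        sum_fourier_weight[OF H(1)] fourier_weight_nonneg eq[of \<alpha>] eq[of \<beta>] by (simp add: s_def)
    moreover have "0 < collision_prob d \<alpha> H"
      using collision_prob_ge_half[OF _ _ H(1), of \<alpha>] assms by simp
    \<comment> \<open>Here \<open>ln (collision_prob d \<beta> H)\<close> is negative, so dividing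
      by it reverses the inequality.\<close>
    ultimately have "s < rho d \<alpha> \<beta> H"
      using P\<beta> by (simp add: rho_eq less_divide_eq)
    then show False using min by simp
  qed
  show ?thesis
  proof (intro allI impI)
    fix h assume h: "pmf H h \<noteq> 0"
    then have hB: "h \<in> boolean_functions d" using H(1) by (auto simp: set_pmf_iff)
    show "dictator d h"
    proof (rule level_one_imp_dictator[OF hB])
      fix S assume "S \<subseteq> {1..d}" "card S \<noteq> 1"
      \<comment> \<open>A vanishing average of squares forces the coefficient to vanish for every
        \<open>h\<close> of positive mass.\<close>
      then have "(\<Sum>h\<in>boolean_functions d. pmf H h * (fourier_coeff d h S)\<^sup>2) = 0"
        using w0 by (simp add: fourier_weight_def)
      then have "pmf H h * (fourier_coeff d h S)\<^sup>2 = 0"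
        using hB by (subst (asm) sum_nonneg_eq_0_iff) (auto simp: finite_boolean_functions)
      then show "fourier_coeff d h S = 0" using h by simp
    qed
  qed
qed

end
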